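(* Let $0<c_i<1$ for $1\le i\le d$, and $|c|<1$. For $\nu\in\mathbb{N}_0^d$, the polynomials $$M_\nu(x;s,c)=\prod_{j=1}^d(\delta_j)_{\nu_j}M_{\nu_j}\Big(x_j;\delta_j,\frac{c_j}{1-|C_{j+1}|}\Big),\qquad \delta_j=s+|\nu^{j+1}|+|X_{j-1}|,$$ where $s>0$, satisfy the difference equation $DM_\nu=\lambda_{|\nu|}M_\nu$, where $\lambda_n=-n$ and $$D=\sum_{1\le i,j\le d}\Big(\delta_{i,j}+\frac{c_i}{1-|c|}\Big)x_j\triangle_i\nabla_j+\sum_{i=1}^d\Big(-x_i+\frac{c_i}{1-|c|}s\Big)\triangle_i$$ (here $\delta_{i,j}$ is the Kronecker delta), and the orthogonality relation $$\sum_{x\in\mathbb{N}_0^d}M_\nu(x;s,c)M_\mu(x;s,c)\,(s)_{|x|}\prod_{i=1}^d\frac{c_i^{x_i}}{x_i!}=\frac{(s)_{|\nu|}}{(1-|c|)^{s}}\prod_{j=1}^d\nu_j!\,\Big(\frac{c_j}{1-|C_{j+1}|}\Big)^{-\nu_j}\delta_{\nu,\mu}.$$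
   Context: $d>1$; $\{e_1,\dots,e_d\}$ is the standard basis of $\mathbb{R}^d$; $\triangle_if(x)=f(x+e_i)-f(x)$, $\nabla_if(x)=f(x)-f(x-e_i)$; $(y)_k=y(y+1)\cdots(y+k-1)$, $(y)_0=1$. $|x|$, $|c|$, $|\nu|$ denote sums of coordinates; $|C_j|=c_j+c_{j+1}+\dots+c_d$ with $|C_{d+1}|=0$; $|\nu^{j+1}|=\nu_{j+1}+\dots+\nu_d$ (zero for $j=d$), $|X_{j-1}|=x_1+\dots+x_{j-1}$ (zero for $j=1$). $\mu,\nu\in\mathbb{N}_0^d$ and $\delta_{\nu,\mu}$ is $1$ if $\nu=\mu$ and $0$ otherwise. Meixner polynomials in one variable: $M_n(x;\beta,q)=\sum_{k=0}^n\frac{(-n)_k(-x)_k}{(\beta)_k\,k!}\big(1-\tfrac1q\big)^k$.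
   Formalization: The printed norm constant is false (e.g. d=2, ν=μ=(0,1), c=(1/4,1/4): true value is 3/2 times the printed one); the right side is multiplied by ∏_j((1-|C_j|)/(1-|c|))^{ν_j}, which equals 1 when ν_j=0 for all j>1. *)

theory Defs
  imports "HOL-Analysis.Analysis"
begin

(* The coordinate set {1,...,d} is an arbitrary finite linearly ordered type 'n,
   so d = CARD('n) and the position-dependent partial sums below are sums over
   initial and final segments of 'n. N_0^d is the type nat ^ 'n. *)

definition vsum :: "'a::comm_monoid_add ^ 'n::finite \<Rightarrow> 'a"
  where "vsum v = (\<Sum>i\<in>UNIV. v $ i)"

definition of_nat_vec :: "nat ^ 'n::finite \<Rightarrow> real ^ 'n"
  where "of_nat_vec x = (\<chi> i. real (x $ i))"

definition fwd_diff :: "'n::finite \<Rightarrow> (real ^ 'n \<Rightarrow> real) \<Rightarrow> real ^ 'n \<Rightarrow> real"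
  where "fwd_diff i f x = f (x + axis i 1) - f x"

definition bwd_diff :: "'n::finite \<Rightarrow> (real ^ 'n \<Rightarrow> real) \<Rightarrow> real ^ 'n \<Rightarrow> real"
  where "bwd_diff i f x = f x - f (x - axis i 1)"

definition meixner :: "nat \<Rightarrow> real \<Rightarrow> real \<Rightarrow> real \<Rightarrow> real"
  where "meixner n x \<beta> q =
    (\<Sum>k=0..n. pochhammer (- real n) k * pochhammer (- x) k / (pochhammer \<beta> k * fact k)
                * (1 - 1 / q) ^ k)"

(* |C_j| = c_j + ... + c_d and |C_{j+1}| = c_{j+1} + ... + c_d *)
definition tail_from :: "real ^ 'n::{finite,linorder} \<Rightarrow> 'n::{finite,linorder} \<Rightarrow> real"
  where "tail_from c j = (\<Sum>i\<in>{j..}. c $ i)"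

definition tail_after :: "real ^ 'n::{finite,linorder} \<Rightarrow> 'n::{finite,linorder} \<Rightarrow> real"
  where "tail_after c j = (\<Sum>i\<in>{j<..}. c $ i)"

(* s + |\<nu>^{j+1}| + |X_{j-1}| *)
definition meixner_shift ::
    "real \<Rightarrow> nat ^ 'n::{finite,linorder} \<Rightarrow> real ^ 'n::{finite,linorder} \<Rightarrow> 'n::{finite,linorder} \<Rightarrow> real"
  where "meixner_shift s \<nu> x j =
    s + real (\<Sum>i\<in>{j<..}. \<nu> $ i) + (\<Sum>i\<in>{..<j}. x $ i)"

definition meixner_formula ::
    "real \<Rightarrow> real ^ 'n::{finite,linorder} \<Rightarrow> nat ^ 'n::{finite,linorder} \<Rightarrow> real ^ 'n::{finite,linorder} \<Rightarrow> real"
  where "meixner_formula s c \<nu> x =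
    (\<Prod>j\<in>UNIV. pochhammer (meixner_shift s \<nu> x j) (\<nu> $ j)
       * meixner (\<nu> $ j) (x $ j) (meixner_shift s \<nu> x j) (c $ j / (1 - tail_after c j)))"

(* The formula divides by (\<delta>_j)_k for k <= \<nu>_j, which vanishes at some real x; since
   (\<delta>_j)_{\<nu>_j} cancels these denominators, it nevertheless defines a polynomial. A polynomial
   is determined by its values where no denominator vanishes: for s > 0 these points
   include all of N_0^d. *)
definition is_meixner_polynomial ::
    "real \<Rightarrow> real ^ 'n::{finite,linorder} \<Rightarrow> nat ^ 'n::{finite,linorder} \<Rightarrow> (real ^ 'n::{finite,linorder} \<Rightarrow> real) \<Rightarrow> bool"
  where "is_meixner_polynomial s c \<nu> p \<longleftrightarrow>
    real_polynomial_function p \<and>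
    (\<forall>x. (\<forall>j. pochhammer (meixner_shift s \<nu> x j) (\<nu> $ j) \<noteq> 0)
          \<longrightarrow> p x = meixner_formula s c \<nu> x)"

definition meixner_operator ::
    "real \<Rightarrow> real ^ 'n::finite \<Rightarrow> (real ^ 'n \<Rightarrow> real) \<Rightarrow> real ^ 'n \<Rightarrow> real"
  where "meixner_operator s c f x =
    (\<Sum>i\<in>UNIV. \<Sum>j\<in>UNIV.
        ((if i = j then 1 else 0) + c $ i / (1 - vsum c)) * x $ j * fwd_diff i (bwd_diff j f) x)
    + (\<Sum>i\<in>UNIV. (- (x $ i) + c $ i / (1 - vsum c) * s) * fwd_diff i f x)"

definition meixner_weight :: "real \<Rightarrow> real ^ 'n::finite \<Rightarrow> nat ^ 'n \<Rightarrow> real"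
  where "meixner_weight s c x =
    pochhammer s (vsum x) * (\<Prod>i\<in>UNIV. (c $ i) ^ (x $ i) / fact (x $ i))"

(* The last factor is absent from the constant as it is sometimes printed, which
   is correct only if \<nu>_j = 0 for all j > 1. It arises because summing over x_j yields
   ((1 - |C_{j+1}|) / (1 - |C_j|)) ^ (s + |\<nu>^{j+1}| + |X_{j-1}|), whose part with exponent
   |\<nu>^{j+1}| does not cancel. For d = 2 and \<nu> = (0,1) the polynomial is
   s + x_1 + (1 - 1/c_2) x_2, with squared norm
   s (1 - |c|)^(-s) (1/c_2) (1 - c_2) / (1 - |c|). *)
definition meixner_norm :: "real \<Rightarrow> real ^ 'n::{finite,linorder} \<Rightarrow> nat ^ 'n::{finite,linorder} \<Rightarrow> real"
  where "meixner_norm s c \<nu> =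
    pochhammer s (vsum \<nu>) / (1 - vsum c) powr s
    * (\<Prod>j\<in>UNIV. fact (\<nu> $ j) * (c $ j / (1 - tail_after c j)) powi (- int (\<nu> $ j)))
    * (\<Prod>j\<in>UNIV. ((1 - tail_from c j) / (1 - vsum c)) ^ (\<nu> $ j))"

end

theory Submission
  imports Defs
begin

text \<open>The factors of the multivariate Meixner polynomial are the rescaled univariate polynomials
$p_n(b, y) = (b)_n M_n(y; b, q)$, which are polynomials in both $b$ and $y$ and satisfy
$p_{n+1}(b, y) = (b + y)\, p_n(b + 1, y) - (y / q)\, p_n(b + 1, y - 1)$. This recursion is taken
as the definition. Write $p'_n$ for $p_{n-1}(b + 1, \cdot)$. Three identities follow by induction
on $n$: a step in $y$ produces $n (1 - 1/q)\, p'_n$ (\<open>scaled_meixner_step_arg\<close>), a step in $b$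
produces $n\, p'_n$ (\<open>scaled_meixner_step_param\<close>), and a combination of values at $b + 1$ gives
$(b + n)\, p_n(b, y)$ (\<open>scaled_meixner_lower_param\<close>).

The multivariate statements are proved by induction on the set \<open>A\<close> of coordinates, adding a new
largest coordinate $m$. The polynomial for \<open>insert m A\<close> is the polynomial for \<open>A\<close> with $s$
replaced by $s + \nu_m$, times $p_{\nu_m}(s + |x_A|, x_m)$ (\<open>partial_meixner_insert\<close>).

Difference equation. The coefficients $\gamma_i = c_i / (1 - |c|)$ of the operator do not change in
this induction. Applied to the product, the operator is a linear combination of values of the
polynomial for \<open>A\<close> at shifted points; the coefficients in it are univariate expressions, and the
three identities and the recursion turn the combination into the equation for \<open>A\<close> with parameter
$s + \nu_m$ (\<open>partial_operator_partial_meixner\<close>).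

Orthogonality. In one variable the recursion is a summation by parts against the weight
$(b)_k q^k / k!$: pairing $p_{n+1}(b)$ with $p_l(b)$ is, up to a constant, pairing $p_n(b + 1)$
with $p_{l-1}(b + 1)$ (\<open>scaled_meixner_orthogonal\<close>). In several variables, summing over $x_m$
first gives zero unless $\nu_m = \mu_m$. Otherwise the powers of $1 - c_m$ that appear turn the
remaining weight into the one for \<open>A\<close> with parameters $s + \nu_m$ and $c_i / (1 - c_m)$
(\<open>partial_weight_rescale\<close>), to which the induction hypothesis applies. The iterated sum equals
the sum over all $x$ since the family is summable: for $\nu = \mu$ its terms are nonnegative, and
the general case is dominated by $|uv| \le u^2 + v^2$ (\<open>partial_meixner_orthogonal\<close>).\<close>

section \<open>Rescaled univariate Meixner polynomials\<close>

text \<open>The rescaled Meixner polynomial $(b)_n M_n(y; b, q)$. The recursion makes sense for every real $b$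
and $y$, also where some $(b)_k$ vanishes, and shows that the value is a polynomial in $(b, y)$.
Where $(b)_n \neq 0$ it agrees with the hypergeometric sum (\<open>scaled_meixner_eq_meixner\<close>).\<close>

primrec scaled_meixner :: "real \<Rightarrow> nat \<Rightarrow> real \<Rightarrow> real \<Rightarrow> real" where
  "scaled_meixner q 0 b y = 1"
| "scaled_meixner q (Suc n) b y =
     (b + y) * scaled_meixner q n (b + 1) y - y / q * scaled_meixner q n (b + 1) (y - 1)"

lemma scaled_meixner_step_arg:
  "scaled_meixner q n b (y + 1) - scaled_meixner q n b y
     = real n * (1 - 1 / q) * scaled_meixner q (n - 1) (b + 1) y"
proof (induction n arbitrary: b y)
  case (Suc n)
  let ?p = "scaled_meixner q"
  let ?z = "1 - 1 / q"
  have up: "?p n (b + 1) (y + 1) = ?p n (b + 1) y + real n * ?z * ?p (n - 1) (b + 2) y"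
    using Suc.IH[of "b + 1" y] by (simp add: algebra_simps)
  have down: "?p n (b + 1) (y - 1) = ?p n (b + 1) y - real n * ?z * ?p (n - 1) (b + 2) (y - 1)"
    using Suc.IH[of "b + 1" "y - 1"] by (simp add: algebra_simps)
  have rec: "real n * ?p n (b + 1) y
      = real n * ((b + 1 + y) * ?p (n - 1) (b + 2) y - y / q * ?p (n - 1) (b + 2) (y - 1))"
    by (cases n) (simp_all add: algebra_simps)
  have "?p (Suc n) b (y + 1) - ?p (Suc n) b y
      = ?z * ?p n (b + 1) y
        + ?z * (real n * ((b + 1 + y) * ?p (n - 1) (b + 2) y - y / q * ?p (n - 1) (b + 2) (y - 1)))"
    by (simp add: up down) (simp add: algebra_simps add_divide_distrib diff_divide_distrib)
  also have "\<dots> = ?z * ?p n (b + 1) y + ?z * (real n * ?p n (b + 1) y)"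
    by (simp only: rec)
  finally show ?case
    by (simp add: algebra_simps)
qed simp

lemma scaled_meixner_step_param:
  "scaled_meixner q n (b + 1) y - scaled_meixner q n b y
     = real n * scaled_meixner q (n - 1) (b + 1) y"
proof (induction n arbitrary: b y)
  case (Suc n)
  let ?p = "scaled_meixner q"
  have up: "?p n (b + 2) y' = ?p n (b + 1) y' + real n * ?p (n - 1) (b + 2) y'" for y'
    using Suc.IH[of "b + 1" y'] by (simp add: algebra_simps)
  have rec: "real n * ?p n (b + 1) y
      = real n * ((b + 1 + y) * ?p (n - 1) (b + 2) y - y / q * ?p (n - 1) (b + 2) (y - 1))"
    by (cases n) (simp_all add: algebra_simps)
  have "?p (Suc n) (b + 1) y - ?p (Suc n) b y
      = ?p n (b + 1) y
        + real n * ((b + 1 + y) * ?p (n - 1) (b + 2) y - y / q * ?p (n - 1) (b + 2) (y - 1))"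
    by (simp add: up add.assoc) (simp add: algebra_simps add_divide_distrib diff_divide_distrib)
  also have "\<dots> = real (Suc n) * ?p n (b + 1) y"
    by (simp only: rec[symmetric]) (simp add: algebra_simps)
  finally show ?case
    by simp
qed simp

lemma scaled_meixner_lower_param:
  "(b + y) * scaled_meixner q n (b + 1) y - y * scaled_meixner q n (b + 1) (y - 1)
     = (b + real n) * scaled_meixner q n b y"
proof (induction n arbitrary: b y)
  case (Suc n)
  let ?p = "scaled_meixner q"
  let ?z = "1 - 1 / q"
  have down: "?p (Suc n) (b + 1) (y - 1)
      = ?p (Suc n) (b + 1) y - real (Suc n) * ?z * ?p n (b + 2) (y - 1)"
    using scaled_meixner_step_arg[of q "Suc n" "b + 1" "y - 1"]
    by (simp add: add.assoc del: scaled_meixner.simps)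
  have par: "?p (Suc n) b y = ?p (Suc n) (b + 1) y - real (Suc n) * ?p n (b + 1) y"
    using scaled_meixner_step_param[of q "Suc n" b y] by (simp del: scaled_meixner.simps)
  have rec: "?p (Suc n) (b + 1) y = (b + 1 + y) * ?p n (b + 2) y - y / q * ?p n (b + 2) (y - 1)"
    by (simp add: add.assoc)
  have IH: "(b + 1 + y) * ?p n (b + 2) y - y * ?p n (b + 2) (y - 1)
      = (b + 1 + real n) * ?p n (b + 1) y"
    using Suc.IH[of "b + 1" y] by (simp add: add.assoc)
  have "(b + y) * ?p (Suc n) (b + 1) y - y * ?p (Suc n) (b + 1) (y - 1)
        - (b + real (Suc n)) * ?p (Suc n) b y
      = real (Suc n) * (y * ?z * ?p n (b + 2) (y - 1) - ?p (Suc n) (b + 1) y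
          + (b + real (Suc n)) * ?p n (b + 1) y)"
    unfolding down par
    by (simp add: algebra_simps add_divide_distrib del: scaled_meixner.simps)
  also have "y * ?z * ?p n (b + 2) (y - 1) - ?p (Suc n) (b + 1) y
          + (b + real (Suc n)) * ?p n (b + 1) y
      = (b + 1 + real n) * ?p n (b + 1) y
         - ((b + 1 + y) * ?p n (b + 2) y - y * ?p n (b + 2) (y - 1))"
    unfolding rec by (simp add: algebra_simps)
  also have "\<dots> = 0"
    by (simp only: IH)
  finally show ?case
    by simp
qed simp

text \<open>The hypergeometric sum with its denominators cancelled: $(b)_n / (b)_k = (b + k)_{n-k}$, and
$(-n)_k / k! = (-1)^k \binom{n}{k}$.\<close>

lemma scaled_meixner_expansion:
  "scaled_meixner q n b y
     = (\<Sum>k\<le>n. real (n choose k) * pochhammer (b + real k) (n - k) * pochhammer (- y) k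
           * (- (1 - 1 / q)) ^ k)"
proof (induction n arbitrary: b y)
  case (Suc n)
  let ?z = "- (1 - 1 / q)"
  let ?t = "\<lambda>k. pochhammer (b + real k) (Suc n - k) * pochhammer (- y) k * ?z ^ k"
  have term_eq: "(b + y) * (real (n choose k) * pochhammer (b + 1 + real k) (n - k)
          * pochhammer (- y) k * ?z ^ k)
        - y / q * (real (n choose k) * pochhammer (b + 1 + real k) (n - k)
          * pochhammer (- (y - 1)) k * ?z ^ k)
      = real (n choose k) * ?t k + real (n choose k) * ?t (Suc k)" if "k \<le> n" for k
  proof -
    have r1: "pochhammer (b + real k) (Suc n - k)
        = (b + real k) * pochhammer (b + 1 + real k) (n - k)"
      using that by (simp add: Suc_diff_le pochhammer_rec algebra_simps)
    have r2: "pochhammer (- y) (Suc k) = (real k - y) * pochhammer (- y) k"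
      by (simp add: pochhammer_rec' algebra_simps)
    have r3: "y * pochhammer (- (y - 1)) k = - ((real k - y) * pochhammer (- y) k)"
      using pochhammer_rec[of "- y" k] r2 by (simp add: algebra_simps)
    have "(b + y) * (real (n choose k) * pochhammer (b + 1 + real k) (n - k)
          * pochhammer (- y) k * ?z ^ k)
        - y / q * (real (n choose k) * pochhammer (b + 1 + real k) (n - k)
          * pochhammer (- (y - 1)) k * ?z ^ k)
      = real (n choose k) * pochhammer (b + 1 + real k) (n - k) * ?z ^ k
        * ((b + y) * pochhammer (- y) k - 1 / q * (y * pochhammer (- (y - 1)) k))"
      by (simp add: algebra_simps)
    also have "(b + y) * pochhammer (- y) k - 1 / q * (y * pochhammer (- (y - 1)) k)
       = (b + real k) * pochhammer (- y) k + ?z * ((real k - y) * pochhammer (- y) k)"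
      unfolding r3 by (simp add: algebra_simps)
    also have "real (n choose k) * pochhammer (b + 1 + real k) (n - k) * ?z ^ k * \<dots>
       = real (n choose k) * ?t k + real (n choose k) * ?t (Suc k)"
      unfolding r1 r2 by (simp add: algebra_simps)
    finally show ?thesis .
  qed
  have "scaled_meixner q (Suc n) b y
      = (\<Sum>k\<le>n. real (n choose k) * ?t k + real (n choose k) * ?t (Suc k))"
    unfolding scaled_meixner.simps Suc.IH sum_distrib_left sum_subtractf[symmetric]
    by (intro sum.cong refl term_eq) simp
  also have "\<dots> = (\<Sum>k\<le>Suc n. real (n choose k) * ?t k) + (\<Sum>k\<le>n. real (n choose k) * ?t (Suc k))"
    by (simp add: sum.distrib)
  also have "\<dots> = ?t 0 + (\<Sum>k\<le>n. real (Suc n choose Suc k) * ?t (Suc k))"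
    by (subst sum.atMost_Suc_shift)
       (simp add: sum.distrib[symmetric] algebra_simps del: pochhammer_Suc power_Suc)
  also have "\<dots> = (\<Sum>k\<le>Suc n. real (Suc n choose k) * ?t k)"
    by (subst sum.atMost_Suc_shift) simp
  finally show ?case
    by (simp only: mult.assoc)
qed simp

lemma scaled_meixner_eq_meixner:
  assumes "pochhammer b n \<noteq> 0"
  shows "scaled_meixner q n b y = pochhammer b n * meixner n y b q"
  unfolding scaled_meixner_expansion meixner_def sum_distrib_left atMost_atLeast0
proof (intro sum.cong refl)
  fix k assume "k \<in> {0..n}"
  then have k: "k \<le> n" by simp
  have split: "pochhammer b n = pochhammer b k * pochhammer (b + real k) (n - k)"
    using k by (rule pochhammer_product)
  then have nz: "pochhammer b k \<noteq> 0"
    using assms by auto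
  have ch: "pochhammer (- real n) k = (- 1) ^ k * real (n choose k) * fact k"
    by (simp add: binomial_gbinomial gbinomial_pochhammer)
  show "real (n choose k) * pochhammer (b + real k) (n - k) * pochhammer (- y) k
           * (- (1 - 1 / q)) ^ k
      = pochhammer b n * (pochhammer (- real n) k * pochhammer (- y) k
           / (pochhammer b k * fact k) * (1 - 1 / q) ^ k)"
    unfolding split ch power_minus[of "1 - 1 / q"] using nz by (simp add: field_simps)
qed

lemma real_polynomial_function_scaled_meixner:
  assumes "real_polynomial_function f" and "real_polynomial_function g"
  shows "real_polynomial_function (\<lambda>x. scaled_meixner q n (f x) (g x))"
  using assms
proof (induction n arbitrary: f g)
  case (Suc n)
  have f1: "real_polynomial_function (\<lambda>x. f x + 1)"
    using Suc.prems by (intro real_polynomial_function.intros(2,3))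
  have g1: "real_polynomial_function (\<lambda>x. g x - 1)"
    using Suc.prems by (intro real_polynomial_function_diff real_polynomial_function.intros(2))
  show ?case
    unfolding scaled_meixner.simps divide_inverse using Suc.prems
    by (intro real_polynomial_function_diff real_polynomial_function.intros(2-4) Suc.IH f1 g1)
qed (simp add: real_polynomial_function.intros)

section \<open>Univariate orthogonality\<close>

text \<open>The orthogonality weight of the univariate Meixner polynomials: the negative binomial weight,
without the normalising factor $(1 - q)^b$.\<close>

definition negbin_weight :: "real \<Rightarrow> real \<Rightarrow> nat \<Rightarrow> real"
  where "negbin_weight q b k = pochhammer b k * q ^ k / fact k"

lemma negbin_weight_mult_up:
  "(b + real k) * negbin_weight q b k = b * negbin_weight q (b + 1) k"
proof -
  have "(b + real k) * pochhammer b k = b * pochhammer (b + 1) k"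
    using pochhammer_rec[of b k] pochhammer_rec'[of b k] by simp
  then show ?thesis
    by (simp add: negbin_weight_def mult.assoc[symmetric])
qed

lemma negbin_weight_mult_down:
  assumes "q \<noteq> 0"
  shows "real (Suc k) / q * negbin_weight q b (Suc k) = b * negbin_weight q (b + 1) k"
proof -
  have "real (Suc k) / q * (q ^ Suc k / fact (Suc k)) = q ^ k / fact k"
    using assms by (simp add: field_simps del: of_nat_Suc)
  then show ?thesis
    by (simp only: negbin_weight_def pochhammer_rec[of b k] times_divide_eq_right[symmetric]
      mult.assoc mult.left_commute[of "real (Suc k) / q"])
qed

lemma negbin_weight_nonneg: "q > 0 \<Longrightarrow> b > 0 \<Longrightarrow> negbin_weight q b k \<ge> 0"
  by (simp add: negbin_weight_def pochhammer_nonneg)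

lemma has_sum_negbin_weight:
  assumes "0 < q" "q < 1" "b > 0"
  shows "(negbin_weight q b has_sum (1 - q) powr (- b)) UNIV"
proof -
  have "(\<lambda>n. (- b gchoose n) * (- q) ^ n) sums (1 + (- q)) powr (- b)"
    using assms by (intro gen_binomial_real) auto
  moreover have "(- b gchoose n) * (- q) ^ n = negbin_weight q b n" for n
    by (simp add: negbin_weight_def gbinomial_pochhammer power_minus[of q])
  ultimately have "negbin_weight q b sums (1 - q) powr (- b)"
    by simp
  then show ?thesis
    using assms by (intro sums_nonneg_imp_has_sum) (auto intro: negbin_weight_nonneg)
qed

lemma has_sum_diff_real:
  fixes f g :: "'a \<Rightarrow> real"
  assumes "(f has_sum a) A" and "(g has_sum b) A"
  shows "((\<lambda>x. f x - g x) has_sum (a - b)) A"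
  using has_sum_add[OF assms(1) has_sum_uminusI[OF assms(2)]] by simp

lemma has_sum_shift_nat:
  fixes f :: "nat \<Rightarrow> real"
  assumes "(f has_sum S) UNIV"
  shows "((\<lambda>k. case k of 0 \<Rightarrow> 0 | Suc k' \<Rightarrow> f k') has_sum S) UNIV"
proof -
  let ?g = "\<lambda>k. case k of 0 \<Rightarrow> 0 | Suc k' \<Rightarrow> f k'"
  have "(?g has_sum S) (range Suc)"
    using assms by (subst has_sum_reindex) (auto simp: o_def)
  then show ?thesis
    by (rule has_sum_cong_neutral[THEN iffD1, rotated -1]) (auto split: nat.splits)
qed

text \<open>The recursion against the weight: multiplied by \<open>negbin_weight q b\<close>, the first term of
$p_{n+1}(b, k)$ becomes $b\, h(k)$ and the second $b\, h(k - 1)$, where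
$h(k) = p_n(b + 1, k)\, w_{b+1}(k)$. The factor \<open>g\<close> is arbitrary, so that summing over $k$ amounts
to a summation by parts.\<close>

lemma scaled_meixner_weight_shift:
  assumes "q \<noteq> 0"
  shows "scaled_meixner q (Suc n) b (real k) * negbin_weight q b k * g k
    = b * (scaled_meixner q n (b + 1) (real k) * negbin_weight q (b + 1) k * g k)
      - b * (case k of 0 \<Rightarrow> 0 | Suc k' \<Rightarrow>
          scaled_meixner q n (b + 1) (real k') * negbin_weight q (b + 1) k' * g (Suc k'))"
proof (cases k)
  case 0
  then show ?thesis
    by (simp add: negbin_weight_def)
next
  case (Suc k')
  have "scaled_meixner q (Suc n) b (real k) * negbin_weight q b k * g k
      = scaled_meixner q n (b + 1) (real k) * ((b + real k) * negbin_weight q b k) * g k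
        - scaled_meixner q n (b + 1) (real k') * (real (Suc k') / q * negbin_weight q b (Suc k')) * g k"
    by (simp add: Suc algebra_simps)
  then show ?thesis
    unfolding negbin_weight_mult_up negbin_weight_mult_down[OF assms] by (simp add: Suc algebra_simps)
qed

lemma has_sum_scaled_meixner:
  assumes q: "0 < q" "q < 1" and "b > 0"
  shows "((\<lambda>k. scaled_meixner q n b (real k) * negbin_weight q b k)
           has_sum (if n = 0 then (1 - q) powr (- b) else 0)) UNIV"
  using \<open>b > 0\<close>
proof (induction n arbitrary: b)
  case 0
  then show ?case
    using has_sum_negbin_weight[OF q] by simp
next
  case (Suc n)
  let ?p = "scaled_meixner q"
  let ?h = "\<lambda>k. scaled_meixner q n (b + 1) (real k) * negbin_weight q (b + 1) k"
  obtain S where S: "(?h has_sum S) UNIV"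
    using Suc.IH[of "b + 1"] Suc.prems by auto
  have "((\<lambda>k. b * ?h k - b * (case k of 0 \<Rightarrow> 0 | Suc k' \<Rightarrow> ?h k')) has_sum (b * S - b * S)) UNIV"
    by (intro has_sum_diff_real has_sum_cmult_right has_sum_shift_nat S)
  moreover have "?p (Suc n) b (real k) * negbin_weight q b k
      = b * ?h k - b * (case k of 0 \<Rightarrow> 0 | Suc k' \<Rightarrow> ?h k')" for k
    using scaled_meixner_weight_shift[of q n b k "\<lambda>_. 1"] q by (simp only: mult_1_right)
  ultimately show ?case
    by (simp del: scaled_meixner.simps)
qed

lemma scaled_meixner_orthogonal:
  assumes q: "0 < q" "q < 1" and "b > 0"
  shows "((\<lambda>k. scaled_meixner q n b (real k) * scaled_meixner q m b (real k) * negbin_weight q b k)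
           has_sum (if n = m then pochhammer b n * fact n * (1 / q) ^ n * (1 - q) powr (- b) else 0))
         UNIV"
  using \<open>b > 0\<close>
proof (induction n arbitrary: b m)
  case 0
  then show ?case
    using has_sum_scaled_meixner[OF q, of b m] by (auto split: if_splits)
next
  case (Suc n)
  let ?p = "scaled_meixner q"
  let ?z = "1 - 1 / q"
  let ?f = "\<lambda>k. ?p n (b + 1) (real k) * negbin_weight q (b + 1) k"
  let ?N = "\<lambda>m. if n = m
      then pochhammer (b + 1) n * fact n * (1 / q) ^ n * (1 - q) powr (- (b + 1)) else 0"
  have IH: "((\<lambda>k. ?f k * ?p m (b + 1) (real k)) has_sum ?N m) UNIV" for m
    using Suc.IH[of "b + 1" m] Suc.prems by (simp add: mult_ac)
  \<comment> \<open>The degree \<open>m\<close> factor is also moved to the parameter \<open>b + 1\<close>, for the induction hypothesis.\<close>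
  have low: "?p m b y = ?p m (b + 1) y - real m * ?p (m - 1) (b + 1) y" for y
    using scaled_meixner_step_param[of q m b y] by simp
  have S: "((\<lambda>k. ?f k * ?p m b (real k)) has_sum (?N m - real m * ?N (m - 1))) UNIV"
    using has_sum_diff_real[OF IH[of m] has_sum_cmult_right[OF IH[of "m - 1"], of "real m"]]
    unfolding low by (simp only: algebra_simps)
  have up: "?p m b (y + 1) = ?p m b y + real m * ?z * ?p (m - 1) (b + 1) y" for y
    using scaled_meixner_step_arg[of q m b y] by simp
  have S': "((\<lambda>k. ?f k * ?p m b (real (Suc k)))
      has_sum (?N m - real m * ?N (m - 1) + real m * ?z * ?N (m - 1))) UNIV"
    using has_sum_add[OF S has_sum_cmult_right[OF IH[of "m - 1"], of "real m * ?z"]]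
    unfolding up of_nat_Suc add.commute[of 1] by (simp only: algebra_simps)
  have alg: "b * u - b * (u + real m * ?z * v) = - (b * real m * ?z * v)" for u v :: real
    by (simp add: algebra_simps)
  have "((\<lambda>k. b * (?f k * ?p m b (real k))
      - b * (case k of 0 \<Rightarrow> 0 | Suc k' \<Rightarrow> ?f k' * ?p m b (real (Suc k')))) has_sum
      (b * (?N m - real m * ?N (m - 1))
        - b * (?N m - real m * ?N (m - 1) + real m * ?z * ?N (m - 1)))) UNIV"
    by (intro has_sum_diff_real has_sum_cmult_right has_sum_shift_nat S S')
  also have "(\<lambda>k. b * (?f k * ?p m b (real k))
      - b * (case k of 0 \<Rightarrow> 0 | Suc k' \<Rightarrow> ?f k' * ?p m b (real (Suc k'))))
    = (\<lambda>k. ?p (Suc n) b (real k) * ?p m b (real k) * negbin_weight q b k)"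
    using scaled_meixner_weight_shift[of q n b _ "\<lambda>k. ?p m b (real k)"] q
    by (intro ext) (simp only: mult_ac)
  also have "b * (?N m - real m * ?N (m - 1))
        - b * (?N m - real m * ?N (m - 1) + real m * ?z * ?N (m - 1))
      = - (b * real m * ?z * ?N (m - 1))"
    by (rule alg)
  also have "- (b * real m * ?z * ?N (m - 1)) = (if Suc n = m
     then pochhammer b (Suc n) * fact (Suc n) * (1 / q) ^ Suc n * (1 - q) powr (- b) else 0)"
  proof (cases "Suc n = m")
    case True
    have "(1 - q) powr (- b) = (1 - q) * (1 - q) powr (- (b + 1))"
      using q powr_add[of "1 - q" 1 "- (b + 1)"] by simp
    moreover have "- ?z = (1 - q) * (1 / q)"
      using q by (simp add: field_simps)
    moreover have "- (b * real m * ?z * ?N (m - 1)) = - ?z * (b * real m * ?N (m - 1))"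
      by (simp only: mult_minus_left mult_ac)
    ultimately show ?thesis
      using True by (auto simp: pochhammer_rec simp del: pochhammer_Suc)
  qed (cases m, auto)
  finally show ?case .
qed

section \<open>The polynomials on a set of coordinates\<close>

text \<open>The product formula restricted to the coordinates in \<open>A\<close>: the partial sums of $\nu$ and $x$ run
over the elements of \<open>A\<close> above and below \<open>j\<close>. The ratios $q_j$ are a separate argument, so that
they can stay fixed while \<open>A\<close>, $s$ and $c$ vary in an induction.\<close>

definition partial_meixner ::
    "'n::{finite,linorder} set \<Rightarrow> real ^ 'n::{finite,linorder} \<Rightarrow> real
      \<Rightarrow> nat ^ 'n::{finite,linorder} \<Rightarrow> real ^ 'n::{finite,linorder} \<Rightarrow> real"
  where "partial_meixner A q s \<nu> x =
    (\<Prod>j\<in>A. scaled_meixner (q $ j) (\<nu> $ j)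
       (s + real (\<Sum>i\<in>A \<inter> {j<..}. \<nu> $ i) + (\<Sum>i\<in>A \<inter> {..<j}. x $ i)) (x $ j))"

lemma partial_meixner_empty [simp]: "partial_meixner {} q s \<nu> x = 1"
  by (simp add: partial_meixner_def)

lemma partial_meixner_insert:
  fixes b :: "'n::{finite,linorder}"
  assumes "\<And>a. a \<in> A \<Longrightarrow> a < b"
  shows "partial_meixner (insert b A) q s \<nu> x
    = partial_meixner A q (s + real (\<nu> $ b)) \<nu> x
      * scaled_meixner (q $ b) (\<nu> $ b) (s + (\<Sum>i\<in>A. x $ i)) (x $ b)"
proof -
  have b: "b \<notin> A"
    using assms by blast
  have above: "insert b A \<inter> {b<..} = {}" and below: "insert b A \<inter> {..<b} = A"
    using assms by force+
  have above': "insert b A \<inter> {j<..} = insert b (A \<inter> {j<..})" if "j \<in> A" for j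
    using assms that by auto
  have below': "insert b A \<inter> {..<j} = A \<inter> {..<j}" if "j \<in> A" for j
    using assms[OF that] by auto
  have "(\<Prod>j\<in>A. scaled_meixner (q $ j) (\<nu> $ j)
       (s + real (\<Sum>i\<in>insert b A \<inter> {j<..}. \<nu> $ i) + (\<Sum>i\<in>insert b A \<inter> {..<j}. x $ i)) (x $ j))
     = partial_meixner A q (s + real (\<nu> $ b)) \<nu> x"
    unfolding partial_meixner_def
    by (intro prod.cong refl) (simp add: above' below' b add.assoc)
  then show ?thesis
    unfolding partial_meixner_def[of "insert b A"] using b by (simp add: above below mult.commute)
qed

lemma partial_meixner_cong:
  assumes "\<And>i. i \<in> A \<Longrightarrow> x $ i = y $ i"
  shows "partial_meixner A q s \<nu> x = partial_meixner A q s \<nu> y"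
  unfolding partial_meixner_def using assms
  by (intro prod.cong arg_cong2[where f = "scaled_meixner _ _"]) auto

lemma real_polynomial_function_partial_meixner:
  "real_polynomial_function (partial_meixner A q s \<nu>)"
  unfolding partial_meixner_def
  by (intro real_polynomial_function_prod real_polynomial_function_scaled_meixner
      real_polynomial_function.intros(2,3) real_polynomial_function_sum)
     (auto intro!: real_polynomial_function.intros(1) bounded_linear_vec_nth)

lemma partial_meixner_UNIV_eq_formula:
  assumes "\<And>j. pochhammer (meixner_shift s \<nu> x j) (\<nu> $ j) \<noteq> 0"
  shows "partial_meixner UNIV (\<chi> j. c $ j / (1 - tail_after c j)) s \<nu> x = meixner_formula s c \<nu> x"
  unfolding partial_meixner_def meixner_formula_def
  using assms by (intro prod.cong refl) (simp add: scaled_meixner_eq_meixner meixner_shift_def)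

section \<open>The difference equation\<close>

text \<open>The difference operator on the coordinates in \<open>A\<close>, with coefficients $\gamma_i$ in place of
$c_i / (1 - |c|)$, and written out in terms of the values of \<open>f\<close> at the shifted points. The terms
$x_j \triangle_j \nabla_j - x_j \triangle_j$ have been combined to $- x_j \nabla_j$.\<close>

definition partial_operator ::
    "'n::finite set \<Rightarrow> ('n \<Rightarrow> real) \<Rightarrow> real \<Rightarrow> (real ^ 'n \<Rightarrow> real) \<Rightarrow> real ^ 'n \<Rightarrow> real"
  where "partial_operator A \<gamma> s f x =
    (\<Sum>j\<in>A. x $ j * f (x - axis j 1)) - (\<Sum>j\<in>A. x $ j) * f x
    + (s + (\<Sum>j\<in>A. x $ j)) * ((\<Sum>i\<in>A. \<gamma> i * f (x + axis i 1)) - (\<Sum>i\<in>A. \<gamma> i) * f x)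
    - (\<Sum>i\<in>A. \<Sum>j\<in>A. \<gamma> i * x $ j * f (x + axis i 1 - axis j 1))
    + (\<Sum>i\<in>A. \<gamma> i) * (\<Sum>j\<in>A. x $ j * f (x - axis j 1))"

lemma meixner_operator_eq_partial_operator:
  "meixner_operator s c f x = partial_operator UNIV (\<lambda>i. c $ i / (1 - vsum c)) s f x"
proof -
  define \<gamma> where "\<gamma> i = c $ i / (1 - vsum c)" for i
  let ?e = "\<lambda>i. axis i (1::real)"
  have "((if i = j then 1 else 0) + \<gamma> i) * x $ j * fwd_diff i (bwd_diff j f) x
      = (if i = j then x $ j * (f (x + ?e i) - 2 * f x + f (x - ?e i)) else 0)
        + (\<gamma> i * f (x + ?e i) * x $ j - \<gamma> i * x $ j * f (x + ?e i - ?e j)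
           - \<gamma> i * (x $ j * f x) + \<gamma> i * (x $ j * f (x - ?e j)))" for i j
    by (simp add: fwd_diff_def bwd_diff_def algebra_simps)
  then have "meixner_operator s c f x
      = (\<Sum>i\<in>UNIV. x $ i * (f (x + ?e i) - 2 * f x + f (x - ?e i)))
        + ((\<Sum>i\<in>UNIV. \<gamma> i * f (x + ?e i)) * (\<Sum>j\<in>UNIV. x $ j)
           - (\<Sum>i\<in>UNIV. \<Sum>j\<in>UNIV. \<gamma> i * x $ j * f (x + ?e i - ?e j))
           - (\<Sum>i\<in>UNIV. \<gamma> i) * (\<Sum>j\<in>UNIV. x $ j * f x)
           + (\<Sum>i\<in>UNIV. \<gamma> i) * (\<Sum>j\<in>UNIV. x $ j * f (x - ?e j)))
        + (\<Sum>i\<in>UNIV. (- (x $ i) + \<gamma> i * s) * (f (x + ?e i) - f x))"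
    unfolding meixner_operator_def \<gamma>_def[symmetric]
    by (simp add: sum.distrib sum_subtractf sum_product fwd_diff_def)
  also have "(\<Sum>i\<in>UNIV. x $ i * (f (x + ?e i) - 2 * f x + f (x - ?e i)))
      = (\<Sum>i\<in>UNIV. x $ i * f (x + ?e i)) - 2 * ((\<Sum>i\<in>UNIV. x $ i) * f x)
        + (\<Sum>i\<in>UNIV. x $ i * f (x - ?e i))"
    by (simp add: algebra_simps sum.distrib sum_subtractf sum_distrib_left)
  also have "(\<Sum>i\<in>UNIV. (- (x $ i) + \<gamma> i * s) * (f (x + ?e i) - f x))
      = (\<Sum>i\<in>UNIV. x $ i) * f x - (\<Sum>i\<in>UNIV. x $ i * f (x + ?e i))
        + s * (\<Sum>i\<in>UNIV. \<gamma> i * f (x + ?e i)) - s * (\<Sum>i\<in>UNIV. \<gamma> i) * f x"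
    by (simp add: algebra_simps sum.distrib sum_subtractf sum_distrib_left)
  also have "(\<Sum>j\<in>UNIV. x $ j * f x) = (\<Sum>j\<in>UNIV. x $ j) * f x"
    by (rule sum_distrib_right[symmetric])
  finally show ?thesis
    unfolding partial_operator_def \<gamma>_def[symmetric] by (simp only: algebra_simps)
qed

text \<open>For $\gamma_i = c_i / (1 - |c|)$ and $q_j = c_j / (1 - |C_{j+1}|)$ on all coordinates, the second
assumption holds since both sides equal $c_j (1 - |C_j|) / ((1 - |c|) (1 - |C_{j+1}|))$.\<close>

lemma partial_operator_partial_meixner:
  fixes A :: "'n::{finite,linorder} set"
  assumes "\<And>j. j \<in> A \<Longrightarrow> q $ j \<noteq> 0"
    and "\<And>j. j \<in> A \<Longrightarrow> \<gamma> j * (1 - q $ j) = q $ j * (1 + (\<Sum>i\<in>A \<inter> {..<j}. \<gamma> i))"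
  shows "partial_operator A \<gamma> s (partial_meixner A q s \<nu>) x
    = - real (\<Sum>j\<in>A. \<nu> $ j) * partial_meixner A q s \<nu> x"
  using finite[of A] assms
proof (induction A arbitrary: s rule: finite_linorder_max_induct)
  case empty
  show ?case
    by (simp add: partial_operator_def)
next
  case (insert b A)
  have bA: "b \<notin> A" and less: "\<And>a. a \<in> A \<Longrightarrow> a < b"
    using insert.hyps by auto
  define n where "n = \<nu> $ b"
  define y where "y = x $ b"
  define F where "F = partial_meixner A q (s + real n) \<nu>"
  define X where "X = (\<Sum>j\<in>A. x $ j)"
  define G where "G = (\<Sum>i\<in>A. \<gamma> i)"
  define \<beta> where "\<beta> = s + X"
  define p where "p = scaled_meixner (q $ b) n"
  let ?e = "\<lambda>i. axis i (1::real)"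
  let ?f = "partial_meixner (insert b A) q s \<nu>"
  define S1 where "S1 = (\<Sum>i\<in>A. \<gamma> i * F (x + ?e i))"
  define S2 where "S2 = (\<Sum>j\<in>A. x $ j * F (x - ?e j))"
  define S3 where "S3 = (\<Sum>i\<in>A. \<Sum>j\<in>A. \<gamma> i * x $ j * F (x + ?e i - ?e j))"

  have below: "insert b A \<inter> {..<j} = A \<inter> {..<j}" if "j \<in> A" for j
    using less[OF that] by auto
  have below_b: "insert b A \<inter> {..<b} = A"
    using less by auto
  have q0: "q $ b \<noteq> 0" and qb: "\<gamma> b * (1 - q $ b) = q $ b * (1 + G)"
    using insert.prems(1)[of b] insert.prems(2)[of b] by (auto simp: below_b G_def)
  have IH: "S2 - X * F x + (s + real n + X) * (S1 - G * F x) - S3 + G * S2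
      = - real (\<Sum>j\<in>A. \<nu> $ j) * F x"
    using insert.IH[of "s + real n"] insert.prems below
    by (simp add: partial_operator_def F_def X_def S1_def S2_def S3_def G_def)

  have f: "?f u = F u * p (s + (\<Sum>i\<in>A. u $ i)) (u $ b)" for u
    using partial_meixner_insert[OF less] by (simp add: F_def p_def n_def)
  have sum_axis: "(\<Sum>i\<in>A. (if i = j then 1 else 0)) = (if j \<in> A then 1 else (0::real))" for j
    by simp
  have F_b: "F (u + ?e b) = F u" "F (u - ?e b) = F u" for u
    unfolding F_def using bA by (auto intro!: partial_meixner_cong simp: axis_def)
  have sumA: "(\<Sum>k\<in>A. (u + ?e i) $ k) = (\<Sum>k\<in>A. u $ k) + (if i \<in> A then 1 else 0)"
       "(\<Sum>k\<in>A. (u - ?e i) $ k) = (\<Sum>k\<in>A. u $ k) - (if i \<in> A then 1 else 0)" for u i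
    by (simp_all add: axis_def sum.distrib sum_subtractf sum_axis)
  have comp: "(u + ?e i) $ b = u $ b + (if i = b then 1 else 0)"
       "(u - ?e i) $ b = u $ b - (if i = b then 1 else 0)" for u i
    by (simp_all add: axis_def)
  note sh = f F_b sumA comp
  have v0: "?f x = F x * p \<beta> y"
    by (simp add: sh \<beta>_def X_def y_def del: vector_add_component vector_minus_component)
  have v1: "?f (x + ?e i) = F (x + ?e i) * p (\<beta> + 1) y" if "i \<in> A" for i
    using that bA by (auto simp: sh \<beta>_def X_def y_def add.assoc
        simp del: vector_add_component vector_minus_component)
  have v1b: "?f (x + ?e b) = F x * p \<beta> (y + 1)"
    using bA by (simp add: sh \<beta>_def X_def y_def del: vector_add_component vector_minus_component)
  have v2: "?f (x - ?e j) = F (x - ?e j) * p (\<beta> - 1) y" if "j \<in> A" for j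
    using that bA by (auto simp: sh \<beta>_def X_def y_def add_diff_eq
        simp del: vector_add_component vector_minus_component)
  have v2b: "?f (x - ?e b) = F x * p \<beta> (y - 1)"
    using bA by (simp add: sh \<beta>_def X_def y_def del: vector_add_component vector_minus_component)
  have v3: "?f (x + ?e i - ?e j) = F (x + ?e i - ?e j) * p \<beta> y" if "i \<in> A" "j \<in> A" for i j
    using that bA by (auto simp: sh \<beta>_def X_def y_def
        simp del: vector_add_component vector_minus_component)
  have v3b: "?f (x + ?e i - ?e b) = F (x + ?e i) * p (\<beta> + 1) (y - 1)" if "i \<in> A" for i
    using that bA by (auto simp: sh \<beta>_def X_def y_def add.assoc
        simp del: vector_add_component vector_minus_component)
  have v3b': "?f (x + ?e b - ?e j) = F (x - ?e j) * p (\<beta> - 1) (y + 1)" if "j \<in> A" for j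
  proof -
    have "x + ?e b - ?e j = x - ?e j + ?e b" by simp
    then show ?thesis
      using that bA by (auto simp only: sh) (auto simp: \<beta>_def X_def y_def add_diff_eq
        simp del: vector_add_component vector_minus_component)
  qed
  have v3bb: "?f (x + ?e b - ?e b) = F x * p \<beta> y"
    by (simp add: v0)

  have w1: "(\<Sum>i\<in>insert b A. \<gamma> i * ?f (x + ?e i)) = S1 * p (\<beta> + 1) y + \<gamma> b * F x * p \<beta> (y + 1)"
    using bA by (simp add: v1 v1b S1_def sum_distrib_right mult.assoc)
  have w2: "(\<Sum>j\<in>insert b A. x $ j * ?f (x - ?e j)) = S2 * p (\<beta> - 1) y + y * F x * p \<beta> (y - 1)"
    using bA by (simp add: v2 v2b S2_def sum_distrib_right mult.assoc y_def)
  have w3: "(\<Sum>i\<in>insert b A. \<Sum>j\<in>insert b A. \<gamma> i * x $ j * ?f (x + ?e i - ?e j))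
      = S3 * p \<beta> y + S1 * y * p (\<beta> + 1) (y - 1) + \<gamma> b * S2 * p (\<beta> - 1) (y + 1)
        + \<gamma> b * y * F x * p \<beta> y"
  proof -
    have "(\<Sum>i\<in>A. \<Sum>j\<in>A. \<gamma> i * x $ j * ?f (x + ?e i - ?e j)) = S3 * p \<beta> y"
      by (simp add: v3 S3_def sum_distrib_right mult.assoc)
    moreover have "(\<Sum>i\<in>A. \<gamma> i * x $ b * ?f (x + ?e i - ?e b)) = S1 * y * p (\<beta> + 1) (y - 1)"
      by (simp add: v3b S1_def sum_distrib_left sum_distrib_right mult_ac y_def)
    moreover have "(\<Sum>j\<in>A. \<gamma> b * x $ j * ?f (x + ?e b - ?e j)) = \<gamma> b * S2 * p (\<beta> - 1) (y + 1)"
      by (simp add: v3b' S2_def sum_distrib_left sum_distrib_right mult_ac del: add_diff_cancel)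
    moreover have "\<gamma> b * x $ b * ?f (x + ?e b - ?e b) = \<gamma> b * y * F x * p \<beta> y"
      unfolding v3bb by (simp add: y_def)
    ultimately show ?thesis
      using bA by (simp only: sum.insert finite sum.distrib not_False_eq_True)
  qed

  \<comment> \<open>In the operator applied to the product, the coefficient of \<open>S1\<close> simplifies by \<open>I1\<close>,
      that of \<open>S2\<close> by \<open>I2\<close> and that of \<open>F x\<close> by \<open>I3\<close>.\<close>
  have I1: "(\<beta> + y) * p (\<beta> + 1) y - y * p (\<beta> + 1) (y - 1) = (\<beta> + real n) * p \<beta> y"
    unfolding p_def by (rule scaled_meixner_lower_param)
  have z: "\<gamma> b * (1 - 1 / q $ b) = - (1 + G)"
    using q0 qb by (simp add: field_simps)
  have I2: "(1 + G) * (p \<beta> y - p (\<beta> - 1) y) = - \<gamma> b * (p (\<beta> - 1) (y + 1) - p (\<beta> - 1) y)"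
  proof -
    have "\<gamma> b * (p (\<beta> - 1) (y + 1) - p (\<beta> - 1) y)
        = \<gamma> b * (1 - 1 / q $ b) * (real n * scaled_meixner (q $ b) (n - 1) \<beta> y)"
      using scaled_meixner_step_arg[of "q $ b" n "\<beta> - 1" y] by (simp add: p_def)
    moreover have "p \<beta> y - p (\<beta> - 1) y = real n * scaled_meixner (q $ b) (n - 1) \<beta> y"
      using scaled_meixner_step_param[of "q $ b" n "\<beta> - 1" y] by (simp add: p_def)
    ultimately show ?thesis
      unfolding z by (simp add: algebra_simps)
  qed
  have I3: "\<gamma> b * ((\<beta> + y) * (p \<beta> (y + 1) - p \<beta> y) - y * (p \<beta> y - p \<beta> (y - 1)))
      - (1 + G) * y * (p \<beta> y - p \<beta> (y - 1)) = - (1 + G) * real n * p \<beta> y"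
  proof -
    let ?r = "\<lambda>v. real n * scaled_meixner (q $ b) (n - 1) (\<beta> + 1) v"
    have up: "p \<beta> (y + 1) - p \<beta> y = (1 - 1 / q $ b) * ?r y"
      using scaled_meixner_step_arg[of "q $ b" n \<beta> y] by (simp add: p_def)
    have down: "p \<beta> y - p \<beta> (y - 1) = (1 - 1 / q $ b) * ?r (y - 1)"
      using scaled_meixner_step_arg[of "q $ b" n \<beta> "y - 1"] by (simp add: p_def)
    have rec: "real n * p \<beta> y = (\<beta> + y) * ?r y - y / q $ b * ?r (y - 1)"
      by (cases n) (simp_all add: p_def algebra_simps add_divide_distrib)
    have z': "(\<gamma> b + (1 + G)) * (1 - 1 / q $ b) = - (1 + G) / q $ b"
    proof -
      have "\<gamma> b + (1 + G) = \<gamma> b / q $ b"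
        using q0 qb by (simp add: field_simps)
      then have "(\<gamma> b + (1 + G)) * (1 - 1 / q $ b) = \<gamma> b * (1 - 1 / q $ b) / q $ b"
        by (simp only: times_divide_eq_left)
      then show ?thesis
        by (simp only: z)
    qed
    have "\<gamma> b * ((\<beta> + y) * (p \<beta> (y + 1) - p \<beta> y) - y * (p \<beta> y - p \<beta> (y - 1)))
      - (1 + G) * y * (p \<beta> y - p \<beta> (y - 1))
      = \<gamma> b * (1 - 1 / q $ b) * ((\<beta> + y) * ?r y)
        - (\<gamma> b + (1 + G)) * (1 - 1 / q $ b) * (y * ?r (y - 1))"
      unfolding up down by (simp only: algebra_simps)
    also have "\<dots> = - (1 + G) * (real n * p \<beta> y)"
      unfolding z z' rec by (simp add: algebra_simps)
    finally show ?thesis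
      by (simp only: mult.assoc)
  qed

  \<comment> \<open>The mixed sum \<open>S3\<close> has the coefficient \<open>- p \<beta> y\<close>, so \<open>IH\<close> must be multiplied by \<open>p \<beta> y\<close>.\<close>
  have "partial_operator (insert b A) \<gamma> s ?f x + real (\<Sum>j\<in>insert b A. \<nu> $ j) * ?f x
      = (S2 - X * F x + (s + real n + X) * (S1 - G * F x) - S3 + G * S2
          + real (\<Sum>j\<in>A. \<nu> $ j) * F x) * p \<beta> y
        + S1 * ((\<beta> + y) * p (\<beta> + 1) y - y * p (\<beta> + 1) (y - 1) - (\<beta> + real n) * p \<beta> y)
        - S2 * ((1 + G) * (p \<beta> y - p (\<beta> - 1) y) + \<gamma> b * (p (\<beta> - 1) (y + 1) - p (\<beta> - 1) y))
        + F x * (\<gamma> b * ((\<beta> + y) * (p \<beta> (y + 1) - p \<beta> y) - y * (p \<beta> y - p \<beta> (y - 1)))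
            - (1 + G) * y * (p \<beta> y - p \<beta> (y - 1)) + (1 + G) * real n * p \<beta> y)"
    unfolding partial_operator_def w1 w2 w3 v0 using bA
    by (simp add: X_def[symmetric] G_def[symmetric] y_def[symmetric] n_def[symmetric] \<beta>_def)
       (simp only: algebra_simps)
  also have "\<dots> = 0"
    unfolding IH I1 I2 I3 by (simp add: algebra_simps)
  finally show ?case
    by simp
qed

section \<open>Multivariate orthogonality\<close>

text \<open>The lattice points over the coordinates in \<open>A\<close>, encoded as vectors that vanish outside \<open>A\<close>.\<close>

definition supported_vecs :: "'n::finite set \<Rightarrow> (nat ^ 'n) set"
  where "supported_vecs A = {x. \<forall>i. i \<notin> A \<longrightarrow> x $ i = 0}"

lemma supported_vecs_empty: "supported_vecs {} = {0}"
  by (auto simp: supported_vecs_def vec_eq_iff)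

lemma supported_vecs_UNIV: "supported_vecs UNIV = UNIV"
  by (simp add: supported_vecs_def)

lemma has_sum_supported_vecs_insert:
  fixes f :: "nat ^ 'n::finite \<Rightarrow> real"
  assumes "b \<notin> A"
  shows "(f has_sum S) (supported_vecs (insert b A)) \<longleftrightarrow>
    ((\<lambda>(x, k). f (x + axis b k)) has_sum S) (supported_vecs A \<times> UNIV)"
proof -
  have "f (x - axis b (x $ b) + axis b (x $ b)) = f x" for x
    by (rule arg_cong[where f = f]) (simp add: vec_eq_iff axis_def)
  moreover have "axis b k $ i = (if i = b then k else 0)" for k :: nat and i
    by (simp add: axis_def)
  ultimately show ?thesis
    by (intro has_sum_reindex_bij_witness[where i = "\<lambda>(x, k). x + axis b k"
          and j = "\<lambda>x. (x - axis b (x $ b), x $ b)"])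
       (use assms in \<open>auto simp: supported_vecs_def vec_eq_iff\<close>)
qed

text \<open>The orthogonality weight $(s)_{|x|} \prod_i c_i^{x_i} / x_i!$ on the coordinates in \<open>A\<close>.\<close>

definition partial_weight :: "'n::finite set \<Rightarrow> real \<Rightarrow> real ^ 'n \<Rightarrow> nat ^ 'n \<Rightarrow> real"
  where "partial_weight A s c x =
    pochhammer s (\<Sum>i\<in>A. x $ i) * (\<Prod>i\<in>A. (c $ i) ^ (x $ i) / fact (x $ i))"

lemma partial_weight_nonneg:
  assumes "s > 0" and "\<And>i. i \<in> A \<Longrightarrow> 0 < c $ i"
  shows "partial_weight A s c x \<ge> 0"
  unfolding partial_weight_def using assms
  by (intro mult_nonneg_nonneg prod_nonneg) (auto simp: pochhammer_nonneg less_imp_le)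

lemma partial_weight_insert:
  assumes "b \<notin> A" and "x \<in> supported_vecs A"
  shows "partial_weight (insert b A) s c (x + axis b k)
    = partial_weight A s c x * negbin_weight (c $ b) (s + real (\<Sum>i\<in>A. x $ i)) k"
proof -
  have b: "(x + axis b k) $ b = k"
    using assms by (simp add: supported_vecs_def axis_def)
  have A: "(x + axis b k) $ i = x $ i" if "i \<in> A" for i
    using assms that by (auto simp: axis_def)
  have "(\<Sum>i\<in>A. (x + axis b k) $ i) = (\<Sum>i\<in>A. x $ i)"
    by (rule sum.cong) (simp_all add: A del: vector_add_component)
  moreover have "(\<Prod>i\<in>A. (c $ i) ^ ((x + axis b k) $ i) / fact ((x + axis b k) $ i))
      = (\<Prod>i\<in>A. (c $ i) ^ (x $ i) / fact (x $ i))"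
    by (rule prod.cong) (simp_all add: A del: vector_add_component)
  ultimately show ?thesis
    using assms
    by (simp add: partial_weight_def negbin_weight_def b pochhammer_product'[symmetric]
        add.commute[of k] del: vector_add_component)
       (simp add: pochhammer_product' mult_ac)
qed

text \<open>Used with $r = 1 - c_m$, where $m$ is the largest coordinate: the left side is what remains of the
weight and the univariate norm after summing over $x_m$.\<close>

lemma partial_weight_rescale:
  assumes "r > 0"
  shows "partial_weight A s c x * (pochhammer (s + real (\<Sum>i\<in>A. x $ i)) n
      * r powr (- (s + real (\<Sum>i\<in>A. x $ i))))
    = pochhammer s n * r powr (- s) * partial_weight A (s + real n) (\<chi> i. c $ i / r) x"
proof -
  let ?X = "\<Sum>i\<in>A. x $ i"
  have "pochhammer s ?X * pochhammer (s + real ?X) n = pochhammer s n * pochhammer (s + real n) ?X"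
    using pochhammer_product'[of s ?X n] pochhammer_product'[of s n ?X] by (simp add: add.commute)
  moreover have "(\<Prod>i\<in>A. (c $ i / r) ^ (x $ i) / fact (x $ i))
      = (\<Prod>i\<in>A. (c $ i) ^ (x $ i) / fact (x $ i)) / r ^ ?X"
    by (simp add: power_divide prod_dividef[symmetric] power_sum mult.commute)
  moreover have "r powr (- (s + real ?X)) = r powr (- s) / r ^ ?X"
    using assms powr_diff[of r "- s" "real ?X"] by (simp add: powr_realpow del: of_nat_sum)
  ultimately show ?thesis
    by (simp add: partial_weight_def del: of_nat_sum)
qed

text \<open>The squared norm of the polynomial on the coordinates in \<open>A\<close>. As in \<open>partial_meixner\<close>, the
ratios $q_j$ are a separate argument.\<close>

definition partial_norm ::
    "'n::{finite,linorder} set \<Rightarrow> real ^ 'n::{finite,linorder} \<Rightarrow> real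
      \<Rightarrow> real ^ 'n::{finite,linorder} \<Rightarrow> nat ^ 'n::{finite,linorder} \<Rightarrow> real"
  where "partial_norm A q s c \<nu> =
    pochhammer s (\<Sum>i\<in>A. \<nu> $ i) * (1 - (\<Sum>i\<in>A. c $ i)) powr (- s)
    * (\<Prod>j\<in>A. fact (\<nu> $ j) * (1 / q $ j) ^ (\<nu> $ j)
         * ((1 - (\<Sum>i\<in>A \<inter> {j..}. c $ i)) / (1 - (\<Sum>i\<in>A. c $ i))) ^ (\<nu> $ j))"

lemma partial_norm_insert:
  fixes b :: "'n::{finite,linorder}"
  assumes less: "\<And>a. a \<in> A \<Longrightarrow> a < b" and c: "c $ b < 1" "(\<Sum>i\<in>insert b A. c $ i) < 1"
    and q: "q $ b = c $ b"
  shows "partial_norm (insert b A) q s c \<nu>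
    = pochhammer s (\<nu> $ b) * (1 - c $ b) powr (- s) * fact (\<nu> $ b) * (1 / c $ b) ^ (\<nu> $ b)
      * partial_norm A q (s + real (\<nu> $ b)) (\<chi> i. c $ i / (1 - c $ b)) \<nu>"
proof -
  define n where "n = \<nu> $ b"
  define r where "r = 1 - c $ b"
  define t where "t = 1 - (\<Sum>i\<in>insert b A. c $ i)"
  have b: "b \<notin> A"
    using less by blast
  have r: "r > 0" and t: "t > 0"
    using c by (simp_all add: r_def t_def)
  have scale: "1 - (\<Sum>i\<in>B. c $ i / r) = (1 - (\<Sum>i\<in>insert b B. c $ i)) / r" if "b \<notin> B" for B
    using that r by (simp add: sum_divide_distrib[symmetric] field_simps) (simp add: r_def)
  have scaleA: "1 - (\<Sum>i\<in>A. c $ i / r) = t / r"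
    unfolding scale[OF b] t_def ..
  have from_b: "insert b A \<inter> {b..} = {b}"
    using less by force
  have from_j: "insert b A \<inter> {j..} = insert b (A \<inter> {j..})" if "j \<in> A" for j
    using less[OF that] by auto
  have "(\<Prod>j\<in>A. fact (\<nu> $ j) * (1 / q $ j) ^ (\<nu> $ j)
         * ((1 - (\<Sum>i\<in>A \<inter> {j..}. c $ i / r)) / (1 - (\<Sum>i\<in>A. c $ i / r))) ^ (\<nu> $ j))
     = (\<Prod>j\<in>A. fact (\<nu> $ j) * (1 / q $ j) ^ (\<nu> $ j)
         * ((1 - (\<Sum>i\<in>insert b A \<inter> {j..}. c $ i)) / t) ^ (\<nu> $ j))" (is "?P = ?Q")
    using b r by (intro prod.cong refl) (simp add: scaleA from_j scale)
  moreover have "(t / r) powr (- (s + real n)) = r powr s * r ^ n * (t powr (- s) / t ^ n)"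
    using r t powr_diff[of "t / r" "- s" "real n"]
    by (simp add: powr_divide powr_realpow powr_minus power_divide field_simps)
  moreover have "r powr (- s) * r powr s = 1"
    using r by (simp add: powr_minus)
  ultimately have tail: "r powr (- s) * ((t / r) powr (- (s + real n)) * ?P)
      = t powr (- s) * ((r / t) ^ n * ?Q)"
    using r t by (simp add: power_divide)
  have "pochhammer s (\<Sum>i\<in>insert b A. \<nu> $ i)
      = pochhammer s n * pochhammer (s + real n) (\<Sum>i\<in>A. \<nu> $ i)"
    using b by (simp add: n_def pochhammer_product')
  moreover have "partial_norm (insert b A) q s c \<nu> = pochhammer s (\<Sum>i\<in>insert b A. \<nu> $ i) * t powr (- s)
      * (fact n * (1 / c $ b) ^ n * (r / t) ^ n * ?Q)"
    unfolding partial_norm_def t_def[symmetric] using b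
    by (simp add: from_b q n_def r_def)
  ultimately have "partial_norm (insert b A) q s c \<nu>
      = pochhammer s n * fact n * (1 / c $ b) ^ n * pochhammer (s + real n) (\<Sum>i\<in>A. \<nu> $ i)
        * (t powr (- s) * ((r / t) ^ n * ?Q))"
    by (simp only: mult_ac)
  also have "\<dots> = pochhammer s n * fact n * (1 / c $ b) ^ n * pochhammer (s + real n) (\<Sum>i\<in>A. \<nu> $ i)
        * (r powr (- s) * ((t / r) powr (- (s + real n)) * ?P))"
    by (simp only: tail)
  also have "\<dots> = pochhammer s n * r powr (- s) * fact n * (1 / c $ b) ^ n
        * partial_norm A q (s + real n) (\<chi> i. c $ i / r) \<nu>"
    by (simp add: partial_norm_def scaleA)
  finally show ?thesis
    unfolding n_def r_def .
qed

lemma partial_meixner_orthogonal: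
  fixes A :: "'n::{finite,linorder} set"
  assumes "s > 0" and "\<And>i. i \<in> A \<Longrightarrow> 0 < c $ i" and "(\<Sum>i\<in>A. c $ i) < 1"
    and "\<And>j. j \<in> A \<Longrightarrow> q $ j = c $ j / (1 - (\<Sum>i\<in>A \<inter> {j<..}. c $ i))"
  shows "((\<lambda>x. partial_meixner A q s \<nu> (of_nat_vec x) * partial_meixner A q s \<mu> (of_nat_vec x)
            * partial_weight A s c x)
          has_sum (if \<forall>i\<in>A. \<nu> $ i = \<mu> $ i then partial_norm A q s c \<nu> else 0)) (supported_vecs A)"
  using finite[of A] assms
proof (induction A arbitrary: s c \<nu> \<mu> rule: finite_linorder_max_induct)
  case empty
  show ?case
    by (rule has_sum_finiteI) (simp_all add: supported_vecs_empty partial_weight_def partial_norm_def)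
next
  case (insert b A)
  have b: "b \<notin> A" and less: "\<And>a. a \<in> A \<Longrightarrow> a < b"
    using insert.hyps by auto
  define r where "r = 1 - c $ b"
  define c' where "c' = (\<chi> i. c $ i / r)"
  let ?F = "\<lambda>s \<nu> x. partial_meixner A q s \<nu> (of_nat_vec x)"
  let ?X = "\<lambda>x. real (\<Sum>i\<in>A. x $ i)"
  let ?p = "\<lambda>n x k. scaled_meixner (c $ b) n (s + ?X x) (real k)"
  define h where "h \<nu> \<mu> x k =
      ?F (s + real (\<nu> $ b)) \<nu> x * ?F (s + real (\<mu> $ b)) \<mu> x * partial_weight A s c x
      * (?p (\<nu> $ b) x k * ?p (\<mu> $ b) x k * negbin_weight (c $ b) (s + ?X x) k)" for \<nu> \<mu> x k
  define C where "C n = pochhammer s n * r powr (- s) * fact n * (1 / c $ b) ^ n" for n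
  define g where "g \<nu> \<mu> x = (if \<nu> $ b = \<mu> $ b
      then C (\<nu> $ b) * (?F (s + real (\<nu> $ b)) \<nu> x * ?F (s + real (\<nu> $ b)) \<mu> x
         * partial_weight A (s + real (\<nu> $ b)) c' x) else 0)" for \<nu> \<mu> x

  have s: "s > 0" and cpos: "\<And>i. i \<in> insert b A \<Longrightarrow> 0 < c $ i"
    and csum: "(\<Sum>i\<in>insert b A. c $ i) < 1"
    using insert.prems by blast+
  have "(\<Sum>i\<in>A. c $ i) \<ge> 0"
    using cpos by (intro sum_nonneg) (auto intro: less_imp_le)
  then have cb: "0 < c $ b" "c $ b < 1"
    using cpos csum b by auto
  have r: "r > 0"
    using cb by (simp add: r_def)
  have above_b: "insert b A \<inter> {b<..} = {}"
    using less by force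
  have above_j: "insert b A \<inter> {j<..} = insert b (A \<inter> {j<..})" if "j \<in> A" for j
    using less[OF that] by auto
  have qb: "q $ b = c $ b"
    using insert.prems(4)[of b] by (simp add: above_b)

  \<comment> \<open>the sum over the new coordinate\<close>
  have inner: "(h \<nu> \<mu> x has_sum g \<nu> \<mu> x) UNIV" for \<nu> \<mu> x
  proof -
    let ?W = "?F (s + real (\<nu> $ b)) \<nu> x * ?F (s + real (\<mu> $ b)) \<mu> x * partial_weight A s c x"
    have pos: "s + ?X x > 0"
      using s by (simp add: add_pos_nonneg sum_nonneg)
    have "(h \<nu> \<mu> x has_sum ?W * (if \<nu> $ b = \<mu> $ b then pochhammer (s + ?X x) (\<nu> $ b) * fact (\<nu> $ b)
        * (1 / c $ b) ^ (\<nu> $ b) * (1 - c $ b) powr (- (s + ?X x)) else 0)) UNIV"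
      unfolding h_def by (intro has_sum_cmult_right scaled_meixner_orthogonal cb pos)
    also have "?W * (if \<nu> $ b = \<mu> $ b then pochhammer (s + ?X x) (\<nu> $ b) * fact (\<nu> $ b)
        * (1 / c $ b) ^ (\<nu> $ b) * (1 - c $ b) powr (- (s + ?X x)) else 0) = g \<nu> \<mu> x"
    proof (cases "\<nu> $ b = \<mu> $ b")
      case True
      then show ?thesis
        using partial_weight_rescale[OF r, of A s c x "\<nu> $ b"]
        by (simp add: g_def C_def c'_def r_def[symmetric] del: of_nat_sum)
    qed (simp add: g_def)
    finally show ?thesis .
  qed

  \<comment> \<open>the sum over the coordinates in \<open>A\<close>\<close>
  have outer: "(g \<nu> \<mu> has_sum
      (if \<forall>i\<in>insert b A. \<nu> $ i = \<mu> $ i then partial_norm (insert b A) q s c \<nu> else 0))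
      (supported_vecs A)" for \<nu> \<mu>
  proof (cases "\<nu> $ b = \<mu> $ b")
    case True
    have scale: "1 - (\<Sum>i\<in>B. c $ i / r) = (1 - (\<Sum>i\<in>insert b B. c $ i)) / r" if "b \<notin> B" for B
      using that r by (simp add: sum_divide_distrib[symmetric] field_simps) (simp add: r_def)
    have "((\<lambda>x. ?F (s + real (\<nu> $ b)) \<nu> x * ?F (s + real (\<nu> $ b)) \<mu> x
         * partial_weight A (s + real (\<nu> $ b)) c' x) has_sum
        (if \<forall>i\<in>A. \<nu> $ i = \<mu> $ i then partial_norm A q (s + real (\<nu> $ b)) c' \<nu> else 0))
       (supported_vecs A)"
    proof (rule insert.IH)
      show "0 < s + real (\<nu> $ b)" and "\<And>i. i \<in> A \<Longrightarrow> 0 < c' $ i"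
        using s cpos r by (auto simp: c'_def)
      have "1 - (\<Sum>i\<in>A. c' $ i) > 0"
        using csum r by (simp add: c'_def scale b del: sum.insert)
      then show "(\<Sum>i\<in>A. c' $ i) < 1"
        by simp
      show "q $ j = c' $ j / (1 - (\<Sum>i\<in>A \<inter> {j<..}. c' $ i))" if "j \<in> A" for j
        using insert.prems(4)[of j] that b r by (simp add: c'_def scale above_j del: sum.insert)
    qed
    then have "((\<lambda>x. C (\<nu> $ b) * (?F (s + real (\<nu> $ b)) \<nu> x * ?F (s + real (\<nu> $ b)) \<mu> x
         * partial_weight A (s + real (\<nu> $ b)) c' x)) has_sum
        C (\<nu> $ b) * (if \<forall>i\<in>A. \<nu> $ i = \<mu> $ i then partial_norm A q (s + real (\<nu> $ b)) c' \<nu> else 0))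
       (supported_vecs A)"
      by (rule has_sum_cmult_right)
    moreover have "C (\<nu> $ b) * partial_norm A q (s + real (\<nu> $ b)) c' \<nu>
        = partial_norm (insert b A) q s c \<nu>"
      using partial_norm_insert[OF less cb(2) csum qb, of s \<nu>] by (simp add: C_def r_def c'_def)
    ultimately show ?thesis
      using True by (cases "\<forall>i\<in>A. \<nu> $ i = \<mu> $ i") (auto simp: g_def[abs_def])
  qed (simp add: g_def[abs_def])

  define u where "u \<nu> x k = ?F (s + real (\<nu> $ b)) \<nu> x * ?p (\<nu> $ b) x k" for \<nu> x k
  define w where "w x k = partial_weight A s c x * negbin_weight (c $ b) (s + ?X x) k" for x k
  have h: "h \<nu> \<mu> x k = u \<nu> x k * u \<mu> x k * w x k" for \<nu> \<mu> x k
    by (simp only: h_def u_def w_def mult_ac)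
  have w: "w x k \<ge> 0" for x k
    using s cb cpos
    by (auto simp: w_def intro!: mult_nonneg_nonneg partial_weight_nonneg negbin_weight_nonneg
        add_pos_nonneg sum_nonneg)
  have diag: "(\<lambda>(x, k). h \<nu> \<nu> x k) summable_on (supported_vecs A \<times> UNIV)" for \<nu>
  proof (rule summable_on_SigmaI)
    show "((\<lambda>k. case (x, k) of (x, k) \<Rightarrow> h \<nu> \<nu> x k) has_sum g \<nu> \<nu> x) UNIV" for x
      using inner[of \<nu> \<nu> x] by simp
    show "g \<nu> \<nu> summable_on supported_vecs A"
      using outer[of \<nu> \<nu>] by (rule has_sum_imp_summable)
    show "0 \<le> (case (x, k) of (x, k) \<Rightarrow> h \<nu> \<nu> x k)" for x k
      using w[of x k] by (simp add: h)
  qed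
  have summable: "(\<lambda>(x, k). h \<nu> \<mu> x k) summable_on (supported_vecs A \<times> UNIV)"
  proof (rule abs_summable_summable, rule Infinite_Sum.abs_summable_on_comparison_test')
    show "(\<lambda>z. (\<lambda>(x, k). h \<nu> \<nu> x k) z + (\<lambda>(x, k). h \<mu> \<mu> x k) z) summable_on (supported_vecs A \<times> UNIV)"
      by (rule summable_on_add[OF diag diag])
    show "norm (case z of (x, k) \<Rightarrow> h \<nu> \<mu> x k)
        \<le> (\<lambda>(x, k). h \<nu> \<nu> x k) z + (\<lambda>(x, k). h \<mu> \<mu> x k) z" for z
    proof (cases z)
      case (Pair x k)
      have "\<bar>u \<nu> x k * u \<mu> x k\<bar> \<le> u \<nu> x k * u \<nu> x k + u \<mu> x k * u \<mu> x k"
        using sum_squares_bound[of "\<bar>u \<nu> x k\<bar>" "\<bar>u \<mu> x k\<bar>"] abs_ge_zero[of "u \<nu> x k * u \<mu> x k"]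
        unfolding abs_mult power2_abs power2_eq_square by linarith
      then have "\<bar>u \<nu> x k * u \<mu> x k\<bar> * w x k
          \<le> (u \<nu> x k * u \<nu> x k + u \<mu> x k * u \<mu> x k) * w x k"
        using w by (rule mult_right_mono)
      then show ?thesis
        using w[of x k] by (simp add: Pair h abs_mult distrib_right)
    qed
  qed
  have "((\<lambda>(x, k). h \<nu> \<mu> x k) has_sum
      (if \<forall>i\<in>insert b A. \<nu> $ i = \<mu> $ i then partial_norm (insert b A) q s c \<nu> else 0))
      (supported_vecs A \<times> UNIV)"
    using inner by (intro has_sum_SigmaI[OF _ outer summable]) simp
  also have "?this \<longleftrightarrow> ((\<lambda>(x, k). partial_meixner (insert b A) q s \<nu> (of_nat_vec (x + axis b k))
        * partial_meixner (insert b A) q s \<mu> (of_nat_vec (x + axis b k))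
        * partial_weight (insert b A) s c (x + axis b k)) has_sum
      (if \<forall>i\<in>insert b A. \<nu> $ i = \<mu> $ i then partial_norm (insert b A) q s c \<nu> else 0))
      (supported_vecs A \<times> UNIV)"
  proof (intro has_sum_cong, clarify)
    fix x k
    assume x: "x \<in> supported_vecs A"
    have at_A: "of_nat_vec (x + axis b k) $ i = of_nat_vec x $ i" if "i \<in> A" for i
      using b that by (auto simp: of_nat_vec_def axis_def)
    have at_b: "of_nat_vec (x + axis b k) $ b = real k"
      using b x by (simp add: of_nat_vec_def axis_def supported_vecs_def)
    have X: "(\<Sum>i\<in>A. of_nat_vec (x + axis b k) $ i) = ?X x"
      by (simp add: at_A) (simp add: of_nat_vec_def)
    have "partial_meixner (insert b A) q s \<nu> (of_nat_vec (x + axis b k))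
        = ?F (s + real (\<nu> $ b)) \<nu> x * ?p (\<nu> $ b) x k" for \<nu>
    proof -
      have "partial_meixner (insert b A) q s \<nu> y = partial_meixner A q (s + real (\<nu> $ b)) \<nu> y
          * scaled_meixner (q $ b) (\<nu> $ b) (s + (\<Sum>i\<in>A. y $ i)) (y $ b)" for y
        using less by (rule partial_meixner_insert)
      moreover have "partial_meixner A q s' \<nu> (of_nat_vec (x + axis b k)) = ?F s' \<nu> x" for s'
        using at_A by (rule partial_meixner_cong)
      ultimately show ?thesis
        by (simp only: at_b X qb)
    qed
    then show "h \<nu> \<mu> x k = partial_meixner (insert b A) q s \<nu> (of_nat_vec (x + axis b k))
        * partial_meixner (insert b A) q s \<mu> (of_nat_vec (x + axis b k))
        * partial_weight (insert b A) s c (x + axis b k)"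
      unfolding partial_weight_insert[OF b x] h_def by (simp only: mult_ac)
  qed
  finally show ?case
    unfolding has_sum_supported_vecs_insert[OF b] .
qed

lemma partial_weight_UNIV: "partial_weight UNIV s c x = meixner_weight s c x"
  by (simp add: partial_weight_def meixner_weight_def vsum_def)

lemma partial_norm_UNIV:
  "partial_norm UNIV (\<chi> j. c $ j / (1 - tail_after c j)) s c \<nu> = meixner_norm s c \<nu>"
proof -
  have "(1 / (c $ j / (1 - tail_after c j))) ^ n = (c $ j / (1 - tail_after c j)) powi (- int n)" for j n
    by (simp add: power_int_minus power_divide inverse_eq_divide)
  then show ?thesis
    unfolding partial_norm_def meixner_norm_def vsum_def[symmetric] tail_from_def
    by (simp add: prod.distrib powr_minus divide_inverse[of _ "_ powr _"])
qed

theorem theorem6p3: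
  fixes c :: "real ^ 'n::{finite,linorder}" and s :: real
  assumes "CARD('n) > 1"
    and "s > 0"
    and "\<And>i. 0 < c $ i" and "\<And>i. c $ i < 1"
    and "vsum c < 1"
  shows "\<exists>M :: nat ^ 'n::{finite,linorder} \<Rightarrow> real ^ 'n::{finite,linorder} \<Rightarrow> real.
    (\<forall>\<nu>. is_meixner_polynomial s c \<nu> (M \<nu>)) \<and>
    (\<forall>\<nu> x. meixner_operator s c (M \<nu>) x = - real (vsum \<nu>) * M \<nu> x) \<and>
    (\<forall>\<nu> \<mu>. ((\<lambda>x. M \<nu> (of_nat_vec x) * M \<mu> (of_nat_vec x) * meixner_weight s c x)
              has_sum (meixner_norm s c \<nu> * (if \<nu> = \<mu> then 1 else 0))) UNIV)"
proof -
  define q where "q = (\<chi> j. c $ j / (1 - tail_after c j))"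
  define \<gamma> where "\<gamma> i = c $ i / (1 - vsum c)" for i
  have after: "tail_after c j < 1" for j
  proof -
    have "tail_after c j \<le> vsum c"
      unfolding tail_after_def vsum_def using assms(3) by (intro sum_mono2) (auto intro: less_imp_le)
    then show ?thesis
      using assms(5) by simp
  qed
  have split: "vsum c = (\<Sum>i\<in>{..<j}. c $ i) + c $ j + tail_after c j" for j
  proof -
    have "(UNIV :: 'n set) = insert j ({..<j} \<union> {j<..})"
      by auto
    then have "vsum c = (\<Sum>i\<in>insert j ({..<j} \<union> {j<..}). c $ i)"
      by (simp add: vsum_def)
    also have "\<dots> = c $ j + (\<Sum>i\<in>{..<j} \<union> {j<..}. c $ i)"
      by (rule sum.insert) auto
    also have "(\<Sum>i\<in>{..<j} \<union> {j<..}. c $ i) = (\<Sum>i\<in>{..<j}. c $ i) + tail_after c j"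
      unfolding tail_after_def by (rule sum.union_disjoint) auto
    finally show ?thesis
      by simp
  qed
  have \<gamma>q: "\<gamma> j * (1 - q $ j) = q $ j * (1 + (\<Sum>i\<in>UNIV \<inter> {..<j}. \<gamma> i))" for j
  proof -
    define S where "S = (\<Sum>i\<in>{..<j}. c $ i)"
    have "(\<Sum>i\<in>UNIV \<inter> {..<j}. \<gamma> i) = S / (1 - vsum c)"
      by (simp add: \<gamma>_def S_def sum_divide_distrib)
    moreover have "1 + S / (1 - vsum c) = (1 - tail_after c j - c $ j) / (1 - vsum c)"
      using assms(5) split[of j] by (simp add: S_def[symmetric] field_simps)
    moreover have "1 - q $ j = (1 - tail_after c j - c $ j) / (1 - tail_after c j)"
      using after[of j] by (simp add: q_def field_simps)
    ultimately show ?thesis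
      by (simp add: \<gamma>_def q_def)
  qed
  have q0: "q $ j \<noteq> 0" for j
    using assms(3)[of j] after[of j] by (simp add: q_def)
  have "is_meixner_polynomial s c \<nu> (partial_meixner UNIV q s \<nu>)" for \<nu>
    unfolding is_meixner_polynomial_def q_def
    using real_polynomial_function_partial_meixner partial_meixner_UNIV_eq_formula by blast
  moreover have "meixner_operator s c (partial_meixner UNIV q s \<nu>) x
      = - real (vsum \<nu>) * partial_meixner UNIV q s \<nu> x" for \<nu> x
    using partial_operator_partial_meixner[of UNIV q \<gamma> s \<nu> x] q0 \<gamma>q
    by (simp add: meixner_operator_eq_partial_operator \<gamma>_def[abs_def] vsum_def del: of_nat_sum)
  moreover have "((\<lambda>x. partial_meixner UNIV q s \<nu> (of_nat_vec x)
        * partial_meixner UNIV q s \<mu> (of_nat_vec x) * meixner_weight s c x)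
      has_sum (meixner_norm s c \<nu> * (if \<nu> = \<mu> then 1 else 0))) UNIV" for \<nu> \<mu>
  proof -
    have qj: "q $ j = c $ j / (1 - (\<Sum>i\<in>UNIV \<inter> {j<..}. c $ i))" for j
      by (simp add: q_def tail_after_def)
    have "(\<forall>i\<in>UNIV. \<nu> $ i = \<mu> $ i) \<longleftrightarrow> \<nu> = \<mu>"
      by (simp add: vec_eq_iff)
    moreover have "meixner_norm s c \<nu> * (if \<nu> = \<mu> then 1 else 0)
        = (if \<nu> = \<mu> then meixner_norm s c \<nu> else 0)"
      by simp
    ultimately show ?thesis
      using partial_meixner_orthogonal[of s UNIV c q \<nu> \<mu>, OF assms(2,3) assms(5)[unfolded vsum_def] qj]
      by (simp only: supported_vecs_UNIV partial_weight_UNIV partial_norm_UNIV[of c s \<nu>, folded q_def])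
  qed
  ultimately show ?thesis
    by (intro exI[of _ "partial_meixner UNIV q s"]) blast
qed

end
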